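(* Let $(x_n)_{n\ge 1}$ be a nonincreasing sequence of positive real numbers such that $\sum_{n} x_n = +\infty$, $\lim_{n\to\infty} x_n = 0$, and $$\liminf_{n\to\infty} \frac{x_{n+1}}{x_n} > \frac12 .$$ Then there exists a constant $\theta\in(0,1)$ (depending only on the sequence $(x_n)$) such that, for each real $\ell>0$, there is a subsequence $(x_{n_k})_{k\ge 1}$ for which $\sum_{k} x_{n_k} = \ell$ and $x_{n_k} = O(\theta^k)$.
   Context: A subsequence $(x_{n_k})_{k\ge1}$ is given by a strictly increasing infinite sequence of indices $n_1<n_2<\cdots$. For a real sequence $(a_k)$ and a function $f:\mathbf{N}\to(0,\infty)$, the notation $a_k=O(f(k))$ means $\limsup_{k\to\infty} a_k/f(k)<\infty$; the implied constant in $x_{n_k}=O(\theta^k)$ may depend on $\ell$ and on the subsequence. *)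

theory Defs
  imports "HOL-Analysis.Analysis"
begin

end

theory Submission
  imports Defs
begin

text \<open>
  The subsequence is chosen greedily: walk through the indices \<open>1, 2, \<dots>\<close>, keep track of the
  amount \<open>\<rho> i\<close> of \<open>l\<close> that is still to be filled after index \<open>i\<close>, and take the term \<open>x (i + 1)\<close>
  exactly when it is strictly smaller than \<open>\<rho> i\<close>.  Strictness keeps the rest positive; as \<open>x\<close> tends
  to \<open>0\<close>, infinitely many terms are therefore taken.

  Geometric decay comes from the invariant \<open>\<rho> i \<le> x i\<close>.  It holds right after any skipped term, and
  divergence of the series forces a skipped term arbitrarily late.  Beyond the point
  where \<open>x i \<le> 2 * x (i + 1)\<close>, it is preserved: after a skip for trivial reasons, and after a take
  because \<open>\<rho> (i + 1) = \<rho> i - x (i + 1) \<le> x i - x (i + 1) \<le> x (i + 1)\<close>.  Under the invariant, a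
  taken term satisfies \<open>\<rho> i \<le> x i \<le> 2 * x (i + 1)\<close>, that is, it fills at least half of the rest.
  From there on every take at least halves the rest.  The rest thus tends to \<open>0\<close>, which makes the
  taken terms sum to \<open>l\<close>, and since the \<open>k\<close>-th taken term is below the rest preceding it, it is
  \<open>O((1/2)^k)\<close>.  Hence \<open>\<theta> = 1/2\<close> works, for every \<open>l\<close> and every such sequence.
\<close>

primrec greedy_rest :: "(nat \<Rightarrow> real) \<Rightarrow> real \<Rightarrow> nat \<Rightarrow> real" where
  "greedy_rest x l 0 = l"
| "greedy_rest x l (Suc i) =
    (if x (Suc i) < greedy_rest x l i then greedy_rest x l i - x (Suc i) else greedy_rest x l i)"

definition greedy_taken :: "(nat \<Rightarrow> real) \<Rightarrow> real \<Rightarrow> nat set" where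
  "greedy_taken x l = {n. n \<ge> 1 \<and> x n < greedy_rest x l (n - 1)}"

lemma greedy_rest_pos: "l > 0 \<Longrightarrow> greedy_rest x l i > 0"
  by (induction i) auto

lemma greedy_rest_constant_between:
  assumes "a \<le> b" and "greedy_taken x l \<inter> {a<..b} = {}"
  shows "greedy_rest x l b = greedy_rest x l a"
  using assms
proof (induction b rule: dec_induct)
  case base
  then show ?case by simp
next
  case (step b)
  from step.prems step.hyps have "Suc b \<notin> greedy_taken x l" by auto
  then have "greedy_rest x l (Suc b) = greedy_rest x l b" by (simp add: greedy_taken_def)
  moreover have "greedy_taken x l \<inter> {a<..b} = {}" using step.prems by auto
  ultimately show ?case using step.IH by simp
qed

text \<open>If only finitely many terms were taken, the rest would eventually stay at a positive constant,
  and the null sequence \<open>x\<close> would drop below it.\<close>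

lemma infinite_greedy_taken:
  assumes "l > 0" and "x \<longlonglongrightarrow> 0"
  shows "infinite (greedy_taken x l)"
proof
  assume "finite (greedy_taken x l)"
  then obtain M where M: "\<And>n. n \<in> greedy_taken x l \<Longrightarrow> n \<le> M"
    by (meson finite_nat_set_iff_bounded_le)
  have const: "greedy_rest x l b = greedy_rest x l M" if "M \<le> b" for b
    using that M by (intro greedy_rest_constant_between) (auto simp: not_less[symmetric])
  have "eventually (\<lambda>n. x n < greedy_rest x l M) sequentially"
    using order_tendstoD(2)[OF assms(2)] greedy_rest_pos[OF assms(1)] by blast
  then obtain n where n: "n \<ge> Suc M" "x n < greedy_rest x l M"
    unfolding eventually_sequentially by (meson nle_le)
  have "greedy_rest x l (n - 1) = greedy_rest x l M" using n(1) by (intro const) simp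
  with n have "n \<in> greedy_taken x l" by (simp add: greedy_taken_def)
  with M n(1) show False by fastforce
qed

text \<open>If every term from some index on were taken, then partial sum plus rest would be constant from
  there on, and positivity of the rest would bound the partial sums.\<close>

lemma greedy_skips_late:
  assumes "l > 0" and "filterlim (\<lambda>N. \<Sum>n=1..N. x n) at_top sequentially"
  shows "\<exists>i\<ge>N. greedy_rest x l (Suc i) \<le> x (Suc i)"
proof (rule ccontr)
  assume "\<not> ?thesis"
  then have take: "x (Suc i) < greedy_rest x l i" if "i \<ge> N" for i
    using that by fastforce
  have sum: "(\<Sum>n=1..i. x n) + greedy_rest x l i = (\<Sum>n=1..N. x n) + greedy_rest x l N"
    if "i \<ge> N" for i
    using that by (induction i rule: dec_induct) (auto simp: take)
  define B where "B = (\<Sum>n=1..N. x n) + greedy_rest x l N"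
  have "eventually (\<lambda>i. B \<le> (\<Sum>n=1..i. x n)) sequentially"
    using assms(2) unfolding filterlim_at_top by blast
  then obtain i where "i \<ge> N" "B \<le> (\<Sum>n=1..i. x n)"
    unfolding eventually_sequentially by (meson nle_le)
  then show False using sum[of i] greedy_rest_pos[OF assms(1), of x i] by (simp add: B_def)
qed

text \<open>This is the invariant that drives the geometric decay: a skip means \<open>\<rho> i \<le> x (i + 1)\<close>, and
  after a take the rest is at most \<open>x i - x (i + 1)\<close>, which is where the factor \<open>2\<close> is exactly
  what is needed.\<close>

lemma greedy_rest_le_term:
  assumes half: "\<And>i. i \<ge> N \<Longrightarrow> x i \<le> 2 * x (Suc i)"
    and start: "M \<ge> N" "greedy_rest x l M \<le> x M"
    and "i \<ge> M"
  shows "greedy_rest x l i \<le> x i"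
  using \<open>i \<ge> M\<close>
proof (induction i rule: dec_induct)
  case base
  then show ?case by (fact start(2))
next
  case (step i)
  have "x i \<le> 2 * x (Suc i)" using step.hyps start(1) by (intro half) simp
  with step.IH show ?case by auto
qed

text \<open>The rest just before the \<open>k\<close>-th take already has all earlier takes subtracted, since nothing
  is taken in between.\<close>

lemma greedy_rest_next_take:
  assumes "infinite (greedy_taken x l)"
  defines "e \<equiv> enumerate (greedy_taken x l)"
  shows "greedy_rest x l (e (Suc k) - 1) = greedy_rest x l (e k - 1) - x (e k)"
proof -
  have mem: "e j \<in> greedy_taken x l" for j
    unfolding e_def using assms(1) by (rule enumerate_in_set)
  have less: "e k < e (Suc k)"
    unfolding e_def by (rule enumerate_step[OF assms(1)])
  have "greedy_taken x l \<inter> {e k<..e (Suc k) - 1} = {}"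
  proof safe
    fix s assume s: "s \<in> greedy_taken x l" "s \<in> {e k<..e (Suc k) - 1}"
    from s less have "e k < s" "s < e (Suc k)" by auto
    moreover have "e (Suc k) = (LEAST t. t \<in> greedy_taken x l \<and> e k < t)"
      unfolding e_def using assms(1) by (rule enumerate_Suc'')
    ultimately show "s \<in> {}" using not_less_Least s(1) by metis
  qed
  then have "greedy_rest x l (e (Suc k) - 1) = greedy_rest x l (e k)"
    using less by (intro greedy_rest_constant_between) auto
  also have "\<dots> = greedy_rest x l (Suc (e k - 1))"
    using mem[of k] by (simp add: greedy_taken_def)
  also have "\<dots> = greedy_rest x l (e k - 1) - x (e k)"
    using mem[of k] by (simp only: greedy_rest.simps) (simp add: greedy_taken_def)
  finally show ?thesis .
qed

lemma greedy_rest_first_take: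
  assumes "infinite (greedy_taken x l)"
  shows "greedy_rest x l (enumerate (greedy_taken x l) 0 - 1) = l"
proof -
  let ?S = "greedy_taken x l"
  let ?e = "enumerate ?S 0"
  have "?e \<in> greedy_taken x l" using assms by (rule enumerate_in_set)
  then have "?e \<ge> 1" by (simp add: greedy_taken_def)
  have "greedy_taken x l \<inter> {0<..?e - 1} = {}"
    using \<open>?e \<ge> 1\<close> Least_le[of "\<lambda>n. n \<in> ?S"] by (fastforce simp: enumerate_0)
  then have "greedy_rest x l (?e - 1) = greedy_rest x l 0"
    by (intro greedy_rest_constant_between) auto
  then show ?thesis by simp
qed

lemma geometric_bound_if_eventually_halving:
  fixes s :: "nat \<Rightarrow> real"
  assumes "\<And>k. k \<ge> K \<Longrightarrow> s (Suc k) \<le> s k / 2" and "k \<ge> K"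
  shows "s k \<le> s K * 2 ^ K * (1 / 2) ^ k"
  using assms(2)
proof (induction k rule: dec_induct)
  case base
  then show ?case by (simp add: power_divide)
next
  case (step k)
  then show ?case using assms(1)[of k] by simp
qed

theorem theorem3:
  fixes x :: "nat \<Rightarrow> real"
  assumes pos: "\<And>n. n \<ge> 1 \<Longrightarrow> x n > 0"
    and noninc: "antimono_on {1..} x"
    and diverges: "filterlim (\<lambda>N. \<Sum>n=1..N. x n) at_top sequentially"
    and lim: "x \<longlonglongrightarrow> 0"
    and ratio: "liminf (\<lambda>n. ereal (x (n + 1) / x n)) > ereal (1 / 2)"
  shows "\<exists>\<theta>::real. 0 < \<theta> \<and> \<theta> < 1 \<and>
    (\<forall>l::real. l > 0 \<longrightarrow>
      (\<exists>n :: nat \<Rightarrow> nat. (\<forall>k\<ge>1. n k \<ge> 1) \<and> strict_mono_on {1..} n \<and>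
        (\<lambda>K. \<Sum>k=1..K. x (n k)) \<longlonglongrightarrow> l \<and>
        limsup (\<lambda>k. ereal (x (n k) / \<theta> ^ k)) < \<infinity>))"
proof (intro exI[of _ "1 / 2 :: real"] conjI allI impI)
  fix l :: real
  assume l: "l > 0"
  from less_LiminfD[OF ratio] obtain N0 where N0: "\<And>n. n \<ge> N0 \<Longrightarrow> 1 / 2 < x (n + 1) / x n"
    unfolding eventually_sequentially by auto
  define N where "N = Suc N0"
  have half: "x i \<le> 2 * x (Suc i)" if "i \<ge> N" for i
    using N0[of i] pos[of i] that by (simp add: N_def field_simps)
  from greedy_skips_late[OF l diverges, of N] obtain M
    where M: "M \<ge> N" "greedy_rest x l M \<le> x M"
    by (meson le_Suc_eq)
  let ?S = "greedy_taken x l"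
  define e where "e = enumerate ?S"
  \<comment> \<open>the rest just before the take with number \<open>k\<close>\<close>
  define s where "s k = greedy_rest x l (e k - 1)" for k
  have inf: "infinite ?S" using l lim by (rule infinite_greedy_taken)
  have mem: "e k \<in> ?S" for k
    unfolding e_def using inf by (rule enumerate_in_set)
  have e_ge_1: "e k \<ge> 1" and below: "x (e k) < s k" for k
    using mem[of k] by (auto simp: greedy_taken_def s_def)
  have mono: "strict_mono e"
    unfolding e_def using inf by (rule strict_mono_enumerate)
  have s_0: "s 0 = l"
    unfolding s_def e_def using inf by (rule greedy_rest_first_take)
  have s_Suc: "s (Suc k) = s k - x (e k)" for k
    unfolding s_def e_def using inf by (rule greedy_rest_next_take)
  have s_pos: "s k > 0" for k
    unfolding s_def using l by (rule greedy_rest_pos)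

  have halving: "s (Suc k) \<le> s k / 2" if "k \<ge> Suc M" for k
  proof -
    have ge: "e k - 1 \<ge> M"
      using strict_mono_imp_increasing[OF mono, of k] that by linarith
    have "s k \<le> x (e k - 1)"
      unfolding s_def by (rule greedy_rest_le_term[OF half M ge])
    also have "\<dots> \<le> 2 * x (e k)"
      using half[of "e k - 1"] ge M(1) e_ge_1[of k] by simp
    finally show ?thesis by (simp add: s_Suc)
  qed
  define C where "C = s (Suc M) * 2 ^ Suc M"
  have bound: "s k \<le> C * (1 / 2) ^ k" if "k \<ge> Suc M" for k
    unfolding C_def using halving that by (rule geometric_bound_if_eventually_halving)
  have "(\<lambda>k. C * (1 / 2) ^ k) \<longlonglongrightarrow> C * 0"
    by (intro tendsto_mult_left LIMSEQ_power_zero) simp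
  then have s_lim: "s \<longlonglongrightarrow> 0"
    using bound s_pos
    by (intro real_tendsto_sandwich[of "\<lambda>_. 0" s sequentially "\<lambda>k. C * (1 / 2) ^ k"])
      (auto intro: eventually_sequentiallyI[of "Suc M"] simp: less_imp_le)

  \<comment> \<open>The subsequence is indexed from \<open>1\<close>, the enumeration of the taken indices from \<open>0\<close>.\<close>
  define n where "n k = e (k - 1)" for k
  have sums: "(\<Sum>k=1..K. x (n k)) = l - s K" for K
    by (induction K) (auto simp: s_0 s_Suc n_def)
  show "\<exists>n :: nat \<Rightarrow> nat. (\<forall>k\<ge>1. n k \<ge> 1) \<and> strict_mono_on {1..} n \<and>
        (\<lambda>K. \<Sum>k=1..K. x (n k)) \<longlonglongrightarrow> l \<and>
        limsup (\<lambda>k. ereal (x (n k) / (1 / 2) ^ k)) < \<infinity>"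
  proof (intro exI[of _ n] conjI)
    show "\<forall>k\<ge>1. n k \<ge> 1" using e_ge_1 by (simp add: n_def)
    show "strict_mono_on {1..} n"
      by (auto simp: n_def intro!: strict_mono_onI strict_monoD[OF mono])
    show "(\<lambda>K. \<Sum>k=1..K. x (n k)) \<longlonglongrightarrow> l"
      using tendsto_diff[OF tendsto_const s_lim, of l] unfolding sums by simp
    have "x (n k) / (1 / 2) ^ k \<le> 2 * C" if "k \<ge> Suc (Suc M)" for k
    proof -
      obtain j where j: "k = Suc j" "j \<ge> Suc M" using \<open>k \<ge> Suc (Suc M)\<close> by (cases k) auto
      have "x (n k) \<le> C * (1 / 2) ^ j"
        using below[of j] bound[OF j(2)] by (simp add: n_def j(1))
      then show ?thesis by (simp add: j(1) field_simps)
    qed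
    then have "eventually (\<lambda>k. ereal (x (n k) / (1 / 2) ^ k) \<le> ereal (2 * C)) sequentially"
      by (intro eventually_sequentiallyI[of "Suc (Suc M)"]) simp
    then have "limsup (\<lambda>k. ereal (x (n k) / (1 / 2) ^ k)) \<le> ereal (2 * C)"
      by (rule Limsup_bounded)
    then show "limsup (\<lambda>k. ereal (x (n k) / (1 / 2) ^ k)) < \<infinity>"
      using le_less_trans by fastforce
  qed
qed simp_all

end
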